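(* Let $d<\infty$ and let $V,W\subset\mathbb{B}_d$ be analytic discs attached to the unit sphere with embedding maps $f$ and $g$ respectively. If $\mathcal{M}_f=\mathcal{M}_g$ (as sets of functions on $\mathbb{D}$), then for all $\xi,\zeta\in\mathbb{T}$, $$f(\xi)=f(\zeta)\iff g(\xi)=g(\zeta),$$ i.e. $f$ and $g$ have the same self-crossings on the boundary.
   Context: $\mathbb{D}$ is the open unit disc, $\mathbb{T}$ the unit circle, $\mathbb{B}_d$ the open Euclidean unit ball of $\mathbb{C}^d$. The Drury–Arveson space $H^2_d$ is the reproducing kernel Hilbert space on $\mathbb{B}_d$ with kernel $1/(1-\langle z,w\rangle)$, and $\mathcal{M}_d$ denotes its multiplier algebra. A variety is a subset of $\mathbb{B}_d$ which is the common zero set of some family of functions from $\mathcal{M}_d$. An analytic disc attached to the unit sphere is a variety $V\subset\mathbb{B}_d$ ($d<\infty$) for which there is an injective analytic map $f:\mathbb{D}\to\mathbb{B}_d$ with $f'(z)\neq0$ for all $z\in\mathbb{D}$, $V=f(\mathbb{D})$, $f$ extends to a $C^2$ map on $\overline{\mathbb{D}}$, and for $x\in\overline{\mathbb{D}}$, $\|f(x)\|=1$ iff $|x|=1$; such $f$ is called an embedding map of $V$. For such $f$, $\mathcal{H}_f$ is the reproducing kernel Hilbert space on $\mathbb{D}$ with kernel $k^f(z,w)=1/(1-\langle f(z),f(w)\rangle)$, and $\mathcal{M}_f$ is its multiplier algebra; equivalently $\mathcal{M}_f=\{\varphi\circ f:\varphi\in\mathcal{M}_d\}$ with the quotient norm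 $\|\psi\|=\inf\{\|\varphi\|_{\mathcal{M}_d}:\varphi\circ f=\psi\}$. *)

theory Defs
  imports "HOL-Analysis.Analysis" "HOL-Library.FuncSet"
begin

definition mono_pow :: "complex^'d::finite \<Rightarrow> ('d \<Rightarrow> nat) \<Rightarrow> complex" where
  "mono_pow z \<alpha> = (\<Prod>i\<in>UNIV. (z $ i) ^ (\<alpha> i))"

definition mi_fact :: "('d::finite \<Rightarrow> nat) \<Rightarrow> real" where
  "mi_fact \<alpha> = (\<Prod>i\<in>UNIV. fact (\<alpha> i))"

definition mi_abs :: "('d::finite \<Rightarrow> nat) \<Rightarrow> nat" where
  "mi_abs \<alpha> = (\<Sum>i\<in>UNIV. \<alpha> i)"

text \<open>Drury-Arveson space H^2_d: functions on the unit ball given by a power series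
  sum_alpha c_alpha z^alpha with sum_alpha |c_alpha|^2 alpha!/|alpha|! finite.
  Only the values on the ball matter.\<close>

definition DA_space :: "(complex^'d::finite \<Rightarrow> complex) set" where
  "DA_space = {h. \<exists>c :: ('d \<Rightarrow> nat) \<Rightarrow> complex.
      (\<lambda>\<alpha>. (cmod (c \<alpha>))\<^sup>2 * mi_fact \<alpha> / fact (mi_abs \<alpha>)) summable_on UNIV \<and>
      (\<forall>z \<in> ball 0 1. ((\<lambda>\<alpha>. c \<alpha> * mono_pow z \<alpha>) has_sum h z) UNIV)}"

definition DA_mult :: "(complex^'d::finite \<Rightarrow> complex) set" where
  "DA_mult = {\<phi>. \<forall>h \<in> DA_space. (\<lambda>z. \<phi> z * h z) \<in> (DA_space :: (complex^'d \<Rightarrow> complex) set)}"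

definition is_variety :: "(complex^'d::finite) set \<Rightarrow> bool" where
  "is_variety V \<longleftrightarrow> (\<exists>F \<subseteq> DA_mult. V = {z \<in> ball 0 1. \<forall>\<phi>\<in>F. \<phi> z = 0})"

definition C2_on_closed_disc :: "(complex \<Rightarrow> complex^'d::finite) \<Rightarrow> bool" where
  "C2_on_closed_disc f \<longleftrightarrow>
     (\<exists>(f1 :: complex \<Rightarrow> (complex \<Rightarrow>\<^sub>L (complex^'d)))
        (f2 :: complex \<Rightarrow> (complex \<Rightarrow>\<^sub>L (complex \<Rightarrow>\<^sub>L (complex^'d)))).
        (\<forall>x \<in> cball 0 1. (f has_derivative blinfun_apply (f1 x)) (at x within cball 0 1)) \<and>
        (\<forall>x \<in> cball 0 1. (f1 has_derivative blinfun_apply (f2 x)) (at x within cball 0 1)) \<and>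
        continuous_on (cball 0 1) f2)"

text \<open>Embedding map of an analytic disc attached to the unit sphere. The function
  f is defined on all of C; its values on the closed unit disc are the C^2 extension.\<close>

definition embedding_map :: "(complex \<Rightarrow> complex^'d::finite) \<Rightarrow> (complex^'d) set \<Rightarrow> bool" where
  "embedding_map f V \<longleftrightarrow>
     is_variety V \<and>
     V = f ` ball 0 1 \<and>
     f ` ball 0 1 \<subseteq> ball 0 1 \<and>
     inj_on f (ball 0 1) \<and>
     (\<forall>i. (\<lambda>z. f z $ i) holomorphic_on ball 0 1) \<and>
     (\<forall>z \<in> ball 0 1. \<exists>i. deriv (\<lambda>w. f w $ i) z \<noteq> 0) \<and>
     C2_on_closed_disc f \<and>
     (\<forall>x \<in> cball 0 1. norm (f x) = 1 \<longleftrightarrow> cmod x = 1)"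

definition analytic_disc_attached :: "(complex^'d::finite) set \<Rightarrow> bool" where
  "analytic_disc_attached V \<longleftrightarrow> (\<exists>f. embedding_map f V)"

definition mult_f :: "(complex \<Rightarrow> complex^'d::finite) \<Rightarrow> (complex \<Rightarrow> complex) set" where
  "mult_f f = {restrict (\<phi> \<circ> f) (ball 0 1) | \<phi>. \<phi> \<in> (DA_mult :: (complex^'d \<Rightarrow> complex) set)}"

end

theory Submission
  imports Defs "HOL-Complex_Analysis.Conformal_Mappings"
begin

text \<open>Each coordinate of g is a multiplier in mult_f g, hence equals \<open>\<phi> \<circ> f\<close> on the disc for some
  multiplier \<open>\<phi>\<close>, and \<open>\<phi>\<close> lies in the Drury--Arveson space because the constant 1 does. Suppose
  \<open>f \<xi> = f \<zeta> = p\<close>. Approach \<open>\<xi>\<close> and \<open>\<zeta>\<close> radially, at speeds such that the images x and y under f both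
  recede from p at unit speed in the direction normal to the sphere; this is possible since the
  normal derivative of f is real (f maps the circle to the sphere) and positive (Hopf's lemma).
  The second-order expansion of f then gives
  \<open>1 - \<langle>x, y\<rangle> = 1 - \<parallel>x\<parallel>\<^sup>2 + O(t\<^sup>2) = 1 - \<parallel>y\<parallel>\<^sup>2 + O(t\<^sup>2)\<close>, all of order t, so the reproducing kernels
  at x and y stay at bounded distance. Approximating \<open>\<phi>\<close> by polynomials yields
  \<open>\<phi> x - \<phi> y \<longlonglongrightarrow> 0\<close>, i.e. the coordinates of g agree at \<open>\<xi>\<close> and \<open>\<zeta>\<close>.\<close>

section \<open>Multinomial coefficients and powers of a finite sum\<close>

text \<open>The complex inner product in the Drury-Arveson kernel; \<open>inner\<close> on this type
  retains only its real part.\<close>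

definition herm :: "complex^'d::finite \<Rightarrow> complex^'d \<Rightarrow> complex" where
  "herm x y = (\<Sum>i\<in>UNIV. x $ i * cnj (y $ i))"

text \<open>The reciprocal of the coefficient weight in \<open>DA_space\<close>, and the coefficient
  of \<open>mono_pow z \<alpha> * cnj (mono_pow w \<alpha>)\<close> in the expansion of the
  kernel.\<close>

definition multinom :: "('d::finite \<Rightarrow> nat) \<Rightarrow> real" where
  "multinom \<alpha> = fact (mi_abs \<alpha>) / mi_fact \<alpha>"

lemma mi_fact_pos: "mi_fact \<alpha> > 0"
  by (simp add: mi_fact_def prod_pos)

lemma multinom_pos: "multinom \<alpha> > 0"
  by (simp add: multinom_def mi_fact_pos)

lemma finite_mi_abs_eq: "finite {\<alpha> :: 'd::finite \<Rightarrow> nat. mi_abs \<alpha> = n}"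
proof (rule finite_subset)
  show "{\<alpha> :: 'd \<Rightarrow> nat. mi_abs \<alpha> = n} \<subseteq> (\<Pi>\<^sub>E i\<in>UNIV. {..n})"
  proof
    fix \<alpha> :: "'d \<Rightarrow> nat"
    assume "\<alpha> \<in> {\<alpha>. mi_abs \<alpha> = n}"
    then have "\<alpha> i \<le> n" for i
      using member_le_sum[of i UNIV \<alpha>] by (auto simp: mi_abs_def)
    then show "\<alpha> \<in> (\<Pi>\<^sub>E i\<in>UNIV. {..n})" by auto
  qed
qed (simp add: finite_PiE)

lemma mi_abs_Suc: "mi_abs (\<beta>(i := Suc (\<beta> i))) = Suc (mi_abs \<beta>)"
  by (simp add: mi_abs_def sum.remove[of UNIV i])

lemma mi_fact_Suc: "mi_fact (\<beta>(i := Suc (\<beta> i))) = real (Suc (\<beta> i)) * mi_fact \<beta>"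
  by (simp add: mi_fact_def prod.remove[of UNIV i])

text \<open>Both sides are (|\<beta>| + 1)! / \<beta>!.\<close>

lemma multinom_Suc:
  "multinom (\<beta>(i := Suc (\<beta> i))) * real (Suc (\<beta> i)) = multinom \<beta> * real (Suc (mi_abs \<beta>))"
  using mi_fact_pos[of \<beta>] unfolding multinom_def mi_abs_Suc mi_fact_Suc
  by (simp add: field_simps del: of_nat_Suc)

lemma prod_pow_Suc:
  fixes u :: "'d::finite \<Rightarrow> 'a::comm_monoid_mult"
  shows "(\<Prod>j\<in>UNIV. u j ^ (\<beta>(i := Suc (\<beta> i))) j) = u i * (\<Prod>j\<in>UNIV. u j ^ \<beta> j)"
  by (simp add: prod.remove[of UNIV i] mult.assoc)

text \<open>In the induction step both sides are multiplied by n + 1, which is the sum of the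
  \<open>\<alpha> i\<close> on the layer of degree n + 1. Writing \<alpha> as \<beta> plus a unit
  vector reduces the share of each coordinate to degree n.\<close>

lemma multinomial_theorem:
  fixes u :: "'d::finite \<Rightarrow> complex"
  shows "(\<Sum>\<alpha> | mi_abs \<alpha> = n. of_real (multinom \<alpha>) * (\<Prod>i\<in>UNIV. u i ^ \<alpha> i)) = (\<Sum>i\<in>UNIV. u i) ^ n"
proof (induction n)
  case 0
  have "{\<alpha> :: 'd \<Rightarrow> nat. mi_abs \<alpha> = 0} = {\<lambda>_. 0}"
    by (auto simp: mi_abs_def)
  then show ?case by (simp add: multinom_def mi_abs_def mi_fact_def)
next
  case (Suc n)
  let ?t = "\<lambda>\<alpha> :: 'd \<Rightarrow> nat. of_real (multinom \<alpha>) * (\<Prod>j\<in>UNIV. u j ^ \<alpha> j)"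
  let ?S = "\<lambda>n. {\<alpha> :: 'd \<Rightarrow> nat. mi_abs \<alpha> = n}"
  have shift: "(\<Sum>\<alpha>\<in>?S (Suc n). of_nat (\<alpha> i) * ?t \<alpha>) = of_nat (Suc n) * (u i * (\<Sum>\<beta>\<in>?S n. ?t \<beta>))" for i
  proof -
    \<comment> \<open>Terms with \<open>\<alpha> i = 0\<close> vanish; once they are dropped,
      decrementing coordinate i is a bijection onto the layer of degree n.\<close>
    have "(\<Sum>\<alpha>\<in>?S (Suc n). of_nat (\<alpha> i) * ?t \<alpha>) = (\<Sum>\<alpha>\<in>{\<alpha>\<in>?S (Suc n). \<alpha> i \<noteq> 0}. of_nat (\<alpha> i) * ?t \<alpha>)"
      by (rule sum.mono_neutral_right) (auto simp: finite_mi_abs_eq)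
    also have "\<dots> = (\<Sum>\<beta>\<in>?S n. of_nat (Suc n) * (u i * ?t \<beta>))"
    proof (rule sum.reindex_bij_witness[where i = "\<lambda>\<beta>. \<beta>(i := Suc (\<beta> i))" and j = "\<lambda>\<alpha>. \<alpha>(i := \<alpha> i - 1)"])
      fix \<alpha> assume a: "\<alpha> \<in> {\<alpha> \<in> ?S (Suc n). \<alpha> i \<noteq> 0}"
      define \<beta> where "\<beta> = \<alpha>(i := \<alpha> i - 1)"
      have \<alpha>: "\<alpha> = \<beta>(i := Suc (\<beta> i))" using a by (auto simp: \<beta>_def)
      have n: "mi_abs \<beta> = n" using a mi_abs_Suc[of \<beta> i] \<alpha> by auto
      show "\<alpha>(i := \<alpha> i - 1, i := Suc ((\<alpha>(i := \<alpha> i - 1)) i)) = \<alpha>"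
        using a by auto
      show "\<alpha>(i := \<alpha> i - 1) \<in> ?S n" using n \<beta>_def by simp
      have "of_nat (\<alpha> i) * ?t \<alpha>
          = of_real (multinom \<alpha> * real (Suc (\<beta> i))) * (\<Prod>j\<in>UNIV. u j ^ \<alpha> j)"
        using \<alpha> a by (simp add: \<beta>_def)
      also have "\<dots> = of_real (multinom \<beta> * real (Suc n)) * (u i * (\<Prod>j\<in>UNIV. u j ^ \<beta> j))"
        using multinom_Suc[of \<beta> i] prod_pow_Suc[of u \<beta> i] \<alpha> n by metis
      finally show "of_nat (Suc n) * (u i * ?t (\<alpha>(i := \<alpha> i - 1))) = of_nat (\<alpha> i) * ?t \<alpha>"
        by (simp add: \<beta>_def del: of_nat_Suc)
    next
      fix \<beta> assume b: "\<beta> \<in> ?S n"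
      then show "\<beta>(i := Suc (\<beta> i)) \<in> {\<alpha> \<in> ?S (Suc n). \<alpha> i \<noteq> 0}"
        using mi_abs_Suc[of \<beta> i] by auto
    qed auto
    finally show ?thesis by (simp add: sum_distrib_left)
  qed
  have "of_nat (Suc n) * (\<Sum>\<alpha>\<in>?S (Suc n). ?t \<alpha>) = (\<Sum>\<alpha>\<in>?S (Suc n). of_nat (mi_abs \<alpha>) * ?t \<alpha>)"
    unfolding sum_distrib_left by (rule sum.cong) simp_all
  also have "\<dots> = (\<Sum>\<alpha>\<in>?S (Suc n). \<Sum>i\<in>UNIV. of_nat (\<alpha> i) * ?t \<alpha>)"
    by (rule sum.cong[OF refl]) (simp only: mi_abs_def of_nat_sum sum_distrib_right)
  also have "\<dots> = (\<Sum>i\<in>UNIV. \<Sum>\<alpha>\<in>?S (Suc n). of_nat (\<alpha> i) * ?t \<alpha>)"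
    by (rule sum.swap)
  also have "\<dots> = of_nat (Suc n) * (\<Sum>i\<in>UNIV. u i) ^ Suc n"
    unfolding shift Suc.IH by (simp add: sum_distrib_left sum_distrib_right mult_ac del: of_nat_Suc)
  finally show ?case
    by (simp only: mult_cancel_left of_nat_eq_0_iff) simp
qed

section \<open>The Hermitian form and the distance of reproducing kernels\<close>

lemma norm_herm_le: "cmod (herm x y) \<le> norm x * norm y"
proof -
  have "cmod (herm x y) \<le> (\<Sum>i\<in>UNIV. \<bar>cmod (x $ i)\<bar> * \<bar>cmod (y $ i)\<bar>)"
    unfolding herm_def by (rule order_trans[OF norm_sum]) (simp add: norm_mult)
  also have "\<dots> \<le> norm x * norm y"
    unfolding norm_vec_def by (rule L2_set_mult_ineq)
  finally show ?thesis .
qed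

lemma herm_self: "herm x x = of_real ((norm x)\<^sup>2)"
  by (simp add: herm_def norm_vec_def L2_set_def sum_nonneg complex_norm_square del: of_real_power)

lemma Re_herm: "Re (herm x y) = inner x y"
  by (simp add: herm_def inner_vec_def inner_complex_def)

lemma cnj_herm: "cnj (herm x y) = herm y x"
  by (simp add: herm_def mult.commute)

lemma herm_diff_left: "herm (x - y) z = herm x z - herm y z"
  by (simp add: herm_def algebra_simps sum_subtractf)

lemma herm_diff_right: "herm x (y - z) = herm x y - herm x z"
  by (simp add: herm_def algebra_simps sum_subtractf)

lemma herm_scaleR_left: "herm (r *\<^sub>R x) y = of_real r * herm x y"
  unfolding herm_def vector_scaleR_component
  by (simp add: sum_distrib_left mult_ac scaleR_conv_of_real)

text \<open>The right-hand side is the squared Drury--Arveson norm of the difference of the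
  reproducing kernels at x and y.\<close>

lemma kernel_diff_bound:
  assumes x: "norm x < 1" and y: "norm y < 1" and F: "finite F"
  shows "(\<Sum>\<alpha>\<in>F. multinom \<alpha> * (cmod (mono_pow x \<alpha> - mono_pow y \<alpha>))\<^sup>2)
    \<le> Re (1 / (1 - herm x x) + 1 / (1 - herm y y) - 2 / (1 - herm x y))" (is "_ \<le> ?K")
proof -
  let ?q = "\<lambda>\<alpha>. multinom \<alpha> * (cmod (mono_pow x \<alpha> - mono_pow y \<alpha>))\<^sup>2"
  define T where "T n = (\<Sum>\<alpha> | mi_abs \<alpha> = n. ?q \<alpha>)" for n
  have lt: "cmod (herm a b) < 1" if "norm a < 1" "norm b < 1" for a b :: "complex^'a"
  proof -
    have "norm a * norm b < 1 * 1"
      using that by (intro mult_strict_mono') auto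
    then show ?thesis using norm_herm_le[of a b] by simp
  qed
  \<comment> \<open>The multinomial theorem for the numbers \<open>a $ i * cnj (b $ i)\<close>,
    whose products separate into a monomial in a and a conjugate monomial in b.\<close>
  have hp: "herm a b ^ n = (\<Sum>\<alpha> | mi_abs \<alpha> = n. of_real (multinom \<alpha>) * (mono_pow a \<alpha> * cnj (mono_pow b \<alpha>)))"
    for a b :: "complex^'a" and n
    using multinomial_theorem[of "\<lambda>i. a $ i * cnj (b $ i)" n]
    by (simp add: herm_def mono_pow_def power_mult_distrib prod.distrib)
  \<comment> \<open>The two cross terms are conjugate to each other, so their real parts
    coincide.\<close>
  have sq: "(cmod (a - b))\<^sup>2 = Re (a * cnj a + b * cnj b - 2 * (a * cnj b))" for a b
    unfolding cmod_power2 by (simp add: power2_eq_square algebra_simps)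
  have T: "T n = Re (herm x x ^ n + herm y y ^ n - 2 * herm x y ^ n)" for n
    unfolding T_def hp sq
    by (simp add: sum_distrib_left sum_distrib_right algebra_simps sum.distrib sum_subtractf)
  \<comment> \<open>Summed over all degrees, each power becomes a geometric series, convergent by
    \<open>lt\<close>.\<close>
  have "T sums ?K"
    unfolding T
    using sums_Re[OF sums_diff[OF sums_add[OF geometric_sums[OF lt[OF x x]] geometric_sums[OF lt[OF y y]]]
        sums_mult[OF geometric_sums[OF lt[OF x y]], of 2]]]
    by simp
  moreover have T0: "T n \<ge> 0" for n
    unfolding T_def by (intro sum_nonneg) (simp add: less_imp_le[OF multinom_pos])
  ultimately have le: "(\<Sum>n<N. T n) \<le> ?K" for N
    by (metis sums_iff sum_le_suminf finite_lessThan)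
  \<comment> \<open>\<open>F\<close> lies in the finitely many homogeneous layers of degree below
    \<open>N\<close>, whose total is a partial sum of a nonnegative series.\<close>
  define N where "N = Suc (Max (mi_abs ` F))"
  have "mi_abs \<alpha> < N" if "\<alpha> \<in> F" for \<alpha>
    unfolding N_def using that F by (simp add: less_Suc_eq_le)
  then have FN: "F \<subseteq> (\<Union>n<N. {\<alpha>. mi_abs \<alpha> = n})"
    by auto
  have "sum ?q F \<le> sum ?q (\<Union>n<N. {\<alpha>. mi_abs \<alpha> = n})"
    by (rule sum_mono2) (use FN in \<open>auto simp: finite_mi_abs_eq less_imp_le[OF multinom_pos]\<close>)
  also have "\<dots> = (\<Sum>n<N. T n)"
    unfolding T_def by (rule sum.UNION_disjoint) (auto simp: finite_mi_abs_eq)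
  finally show ?thesis using le[of N] by linarith
qed

text \<open>Finitely many terms of the power series form a polynomial, whose values at X and Y have
  the same limit. The remaining terms are controlled by Cauchy-Schwarz: a small tail of the norm of
  h times the distance of the kernels, which \<open>K\<close> bounds.\<close>

lemma DA_space_diff_tendsto_0:
  fixes X Y :: "'a \<Rightarrow> complex^'d::finite"
  assumes h: "h \<in> DA_space"
    and X: "(X \<longlongrightarrow> p) \<F>" and Y: "(Y \<longlongrightarrow> p) \<F>"
    and ball: "\<forall>\<^sub>F t in \<F>. norm (X t) < 1 \<and> norm (Y t) < 1"
    and K: "\<forall>\<^sub>F t in \<F>. Re (1 / (1 - herm (X t) (X t)) + 1 / (1 - herm (Y t) (Y t))
              - 2 / (1 - herm (X t) (Y t))) \<le> K"
  shows "((\<lambda>t. h (X t) - h (Y t)) \<longlongrightarrow> 0) \<F>"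
proof (rule tendstoI)
  fix e :: real assume e: "e > 0"
  obtain c where sm: "(\<lambda>\<alpha>. (cmod (c \<alpha>))\<^sup>2 * mi_fact \<alpha> / fact (mi_abs \<alpha>)) summable_on UNIV"
    and hs: "\<And>z. z \<in> ball 0 1 \<Longrightarrow> ((\<lambda>\<alpha>. c \<alpha> * mono_pow z \<alpha>) has_sum h z) UNIV"
    using h by (auto simp: DA_space_def)
  define w where "w \<alpha> = (cmod (c \<alpha>))\<^sup>2 / multinom \<alpha>" for \<alpha>
  have w0: "w \<alpha> \<ge> 0" for \<alpha>
    by (simp add: w_def less_imp_le[OF multinom_pos])
  have ws: "w summable_on UNIV"
    using sm by (simp add: w_def[abs_def] multinom_def)
  \<comment> \<open>\<open>L\<close> is a positive bound for the squared kernel distance whatever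
    the sign of \<open>K\<close>; \<open>d\<close> is chosen so that sqrt (d * L) = e / 2.\<close>
  define L where "L = \<bar>K\<bar> + 1"
  define d where "d = (e/2)\<^sup>2 / L"
  have L: "L > 0" and d: "d > 0" using e by (auto simp: L_def d_def)
  have "\<forall>\<^sub>F F in finite_subsets_at_top UNIV. dist (sum w F) (infsum w UNIV) < d"
    using tendstoD[OF has_sum_infsum[OF ws, unfolded has_sum_def] d] .
  then obtain F0 where F0: "finite F0" "\<And>F. finite F \<Longrightarrow> F0 \<subseteq> F \<Longrightarrow> dist (sum w F) (infsum w UNIV) < d"
    by (auto simp: eventually_finite_subsets_at_top)
  \<comment> \<open>As \<open>w\<close> is nonnegative, the sum over \<open>F0 \<union> G\<close>
    lies between the sum over \<open>F0\<close> and the total, which differ by less than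
    \<open>d\<close>.\<close>
  have tail: "sum w G < d" if G: "finite G" "G \<inter> F0 = {}" for G
  proof -
    have "sum w (F0 \<union> G) = sum w F0 + sum w G"
      using G F0(1) by (intro sum.union_disjoint) auto
    moreover have "sum w (F0 \<union> G) \<le> infsum w UNIV"
      using G F0(1) ws w0 by (intro finite_sum_le_infsum) auto
    ultimately show ?thesis using F0(2)[of F0] F0(1) by (auto simp: dist_real_def)
  qed
  define P where "P z = (\<Sum>\<alpha>\<in>F0. c \<alpha> * mono_pow z \<alpha>)" for z
  have cont: "((\<lambda>t. P (Z t)) \<longlongrightarrow> P p) \<F>" if "(Z \<longlongrightarrow> p) \<F>" for Z
    unfolding P_def mono_pow_def by (intro tendsto_intros that)
  have "((\<lambda>t. P (X t) - P (Y t)) \<longlongrightarrow> 0) \<F>"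
    using tendsto_diff[OF cont[OF X] cont[OF Y]] by simp
  then have "\<forall>\<^sub>F t in \<F>. dist (P (X t) - P (Y t)) 0 < e/2"
    using e by (intro tendstoD) auto
  with ball K show "\<forall>\<^sub>F t in \<F>. dist (h (X t) - h (Y t)) 0 < e"
  proof eventually_elim
    case (elim t)
    let ?D = "\<lambda>\<alpha>. mono_pow (X t) \<alpha> - mono_pow (Y t) \<alpha>"
    have "((\<lambda>\<alpha>. c \<alpha> * ?D \<alpha>) has_sum (h (X t) - h (Y t))) UNIV"
      using has_sum_add[OF hs[of "X t"] has_sum_uminusI[OF hs[of "Y t"]]] elim by (simp add: algebra_simps)
    \<comment> \<open>It suffices to bound the partial sums over all finite sets containing
      \<open>F0\<close> and pass to the limit.\<close>
    then have lim: "((\<lambda>F. norm (sum (\<lambda>\<alpha>. c \<alpha> * ?D \<alpha>) F)) \<longlongrightarrow> norm (h (X t) - h (Y t))) (finite_subsets_at_top UNIV)"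
      unfolding has_sum_def by (rule tendsto_norm)
    have "\<forall>\<^sub>F F in finite_subsets_at_top UNIV.
        norm (sum (\<lambda>\<alpha>. c \<alpha> * ?D \<alpha>) F) \<le> norm (P (X t) - P (Y t)) + e/2"
      unfolding eventually_finite_subsets_at_top
    proof (intro exI[of _ F0] conjI allI impI)
      fix F assume F: "finite F \<and> F0 \<subseteq> F \<and> F \<subseteq> UNIV"
      define G where "G = F - F0"
      have G: "finite G" "G \<inter> F0 = {}" using F by (auto simp: G_def)
      \<comment> \<open>The modulus of \<open>c \<alpha>\<close> is
        \<open>sqrt (w \<alpha>) * sqrt (multinom \<alpha>)\<close>; with this splitting
        Cauchy-Schwarz separates the tail of h from the sum bounded in
        \<open>kernel_diff_bound\<close>.\<close>
      have "cmod (\<Sum>\<alpha>\<in>G. c \<alpha> * ?D \<alpha>) \<le> (\<Sum>\<alpha>\<in>G. \<bar>sqrt (w \<alpha>)\<bar> * \<bar>sqrt (multinom \<alpha>) * cmod (?D \<alpha>)\<bar>)"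
      proof (rule order_trans[OF norm_sum], rule sum_mono)
        fix \<alpha>
        show "norm (c \<alpha> * ?D \<alpha>) \<le> \<bar>sqrt (w \<alpha>)\<bar> * \<bar>sqrt (multinom \<alpha>) * cmod (?D \<alpha>)\<bar>"
          using multinom_pos[of \<alpha>] by (simp add: w_def norm_mult real_sqrt_divide abs_mult)
      qed
      also have "\<dots> \<le> L2_set (\<lambda>\<alpha>. sqrt (w \<alpha>)) G * L2_set (\<lambda>\<alpha>. sqrt (multinom \<alpha>) * cmod (?D \<alpha>)) G"
        by (rule L2_set_mult_ineq)
      also have "\<dots> = sqrt (sum w G * (\<Sum>\<alpha>\<in>G. multinom \<alpha> * (cmod (?D \<alpha>))\<^sup>2))"
        using w0 by (simp add: L2_set_def real_sqrt_mult power_mult_distrib less_imp_le[OF multinom_pos])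
      also have "\<dots> \<le> sqrt (d * L)"
      proof (rule real_sqrt_le_mono, rule mult_mono)
        show "sum w G \<le> d" using tail[OF G] by simp
        show "(\<Sum>\<alpha>\<in>G. multinom \<alpha> * (cmod (?D \<alpha>))\<^sup>2) \<le> L"
          using kernel_diff_bound[of "X t" "Y t" G] G elim by (auto simp: L_def)
        show "0 \<le> (\<Sum>\<alpha>\<in>G. multinom \<alpha> * (cmod (?D \<alpha>))\<^sup>2)"
          by (intro sum_nonneg) (simp add: less_imp_le[OF multinom_pos])
      qed (use d in simp)
      also have "\<dots> = e/2" using L e by (simp add: d_def)
      finally have "cmod (\<Sum>\<alpha>\<in>G. c \<alpha> * ?D \<alpha>) \<le> e/2" .
      moreover have "(\<Sum>\<alpha>\<in>F. c \<alpha> * ?D \<alpha>) = (P (X t) - P (Y t)) + (\<Sum>\<alpha>\<in>G. c \<alpha> * ?D \<alpha>)"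
        using F sum.subset_diff[of F0 F "\<lambda>\<alpha>. c \<alpha> * ?D \<alpha>"]
        by (simp add: G_def P_def algebra_simps sum_subtractf)
      ultimately show "norm (sum (\<lambda>\<alpha>. c \<alpha> * ?D \<alpha>) F) \<le> norm (P (X t) - P (Y t)) + e/2"
        by (smt (verit) norm_triangle_ineq)
    qed (use F0 in auto)
    then have "norm (h (X t) - h (Y t)) \<le> norm (P (X t) - P (Y t)) + e/2"
      by (intro tendsto_le[OF _ tendsto_const lim]) auto
    then show ?case using elim by (simp add: dist_norm)
  qed
qed

section \<open>The constant 1 and the coordinate functions\<close>

text \<open>Makes every multiplier a member of \<open>DA_space\<close>, as its own product with
  1.\<close>

lemma one_in_DA_space: "(\<lambda>_. 1) \<in> (DA_space :: (complex^'d::finite \<Rightarrow> complex) set)"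
proof -
  let ?c = "\<lambda>\<alpha> :: 'd \<Rightarrow> nat. if \<alpha> = (\<lambda>_. 0) then 1 else 0 :: complex"
  have "(\<lambda>\<alpha>. (cmod (?c \<alpha>))\<^sup>2 * mi_fact \<alpha> / fact (mi_abs \<alpha>)) summable_on UNIV"
    by (rule finite_nonzero_values_imp_summable_on)
      (rule finite_subset[of _ "{\<lambda>_. 0}"], auto)
  moreover have "((\<lambda>\<alpha>. ?c \<alpha> * mono_pow z \<alpha>) has_sum 1) UNIV" for z :: "complex^'d"
    by (rule has_sum_finite_neutralI[of "{\<lambda>_. 0}"]) (auto simp: mono_pow_def)
  ultimately show ?thesis
    unfolding DA_space_def by (intro CollectI exI[of _ ?c]) auto
qed

text \<open>Multiplication by \<open>z $ i\<close> shifts the coefficients by one in direction i,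
  and the shift changes the weight by the factor (\<beta> i + 1) / (|\<beta>| + 1), which is at most
  1.\<close>

lemma coord_in_DA_mult: "(\<lambda>z. z $ i) \<in> (DA_mult :: (complex^'d::finite \<Rightarrow> complex) set)"
proof -
  have "(\<lambda>z. z $ i * h z) \<in> DA_space" if h: "h \<in> DA_space" for h :: "complex^'d \<Rightarrow> complex"
  proof -
    obtain c where sm: "(\<lambda>\<alpha>. (cmod (c \<alpha>))\<^sup>2 * mi_fact \<alpha> / fact (mi_abs \<alpha>)) summable_on UNIV"
      and hs: "\<And>z. z \<in> ball 0 1 \<Longrightarrow> ((\<lambda>\<alpha>. c \<alpha> * mono_pow z \<alpha>) has_sum h z) UNIV"
      using h by (auto simp: DA_space_def)
    define s :: "('d \<Rightarrow> nat) \<Rightarrow> 'd \<Rightarrow> nat" where "s \<beta> = \<beta>(i := Suc (\<beta> i))" for \<beta>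
    \<comment> \<open>The coefficients of the product. The case \<open>\<alpha> i = 0\<close> is
      exactly the complement of the range of \<open>s\<close>, where truncated subtraction would
      give a wrong value.\<close>
    define c' where "c' \<alpha> = (if \<alpha> i = 0 then 0 else c (\<alpha>(i := \<alpha> i - 1)))" for \<alpha>
    have inj: "inj s"
      by (rule inj_on_inverseI[of _ "\<lambda>\<alpha>. \<alpha>(i := \<alpha> i - 1)"]) (auto simp: s_def)
    have c's: "c' (s \<beta>) = c \<beta>" for \<beta>
      by (simp add: c'_def s_def)
    have c'0: "c' \<alpha> = 0" if "\<alpha> \<notin> range s" for \<alpha>
    proof (rule ccontr)
      assume "c' \<alpha> \<noteq> 0"
      then have "\<alpha> = s (\<alpha>(i := \<alpha> i - 1))" by (auto simp: c'_def s_def split: if_splits)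
      with that show False by blast
    qed
    let ?w = "\<lambda>c \<alpha>. (cmod (c \<alpha>))\<^sup>2 * mi_fact \<alpha> / fact (mi_abs \<alpha>)"
    have "(\<lambda>\<beta>. ?w c' (s \<beta>)) summable_on UNIV"
    proof (rule summable_on_comparison_test[OF sm])
      fix \<beta> :: "'d \<Rightarrow> nat"
      have "\<beta> i \<le> mi_abs \<beta>" by (simp add: mi_abs_def member_le_sum)
      then have "real (Suc (\<beta> i)) / real (Suc (mi_abs \<beta>)) \<le> 1" by simp
      then have "?w c \<beta> * (real (Suc (\<beta> i)) / real (Suc (mi_abs \<beta>))) \<le> ?w c \<beta> * 1"
        by (intro mult_left_mono) (auto simp: less_imp_le[OF mi_fact_pos])
      moreover have "?w c' (s \<beta>) = ?w c \<beta> * (real (Suc (\<beta> i)) / real (Suc (mi_abs \<beta>)))"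
        unfolding c's unfolding s_def mi_fact_Suc mi_abs_Suc by (simp add: field_simps)
      ultimately show "?w c' (s \<beta>) \<le> ?w c \<beta>" by simp
    qed (simp add: less_imp_le[OF mi_fact_pos])
    then have "?w c' summable_on range s"
      using summable_on_reindex[of s UNIV "?w c'"] inj by (simp add: o_def)
    then have 1: "?w c' summable_on UNIV"
      by (rule summable_on_cong_neutral[THEN iffD1, rotated -1]) (auto simp: c'0)
    have 2: "((\<lambda>\<alpha>. c' \<alpha> * mono_pow z \<alpha>) has_sum (z $ i * h z)) UNIV" if z: "z \<in> ball 0 1" for z
    proof -
      have "((\<lambda>\<beta>. z $ i * (c \<beta> * mono_pow z \<beta>)) has_sum (z $ i * h z)) UNIV"
        by (rule has_sum_cmult_right[OF hs[OF z]])
      moreover have "z $ i * (c \<beta> * mono_pow z \<beta>) = c' (s \<beta>) * mono_pow z (s \<beta>)" for \<beta>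
        unfolding c's unfolding mono_pow_def s_def prod_pow_Suc by (simp add: mult_ac)
      ultimately have "((\<lambda>\<alpha>. c' \<alpha> * mono_pow z \<alpha>) has_sum (z $ i * h z)) (range s)"
        using has_sum_reindex[of s UNIV "\<lambda>\<alpha>. c' \<alpha> * mono_pow z \<alpha>"] inj by (simp add: o_def)
      then show ?thesis
        by (rule has_sum_cong_neutral[THEN iffD1, rotated -1]) (auto simp: c'0)
    qed
    show ?thesis unfolding DA_space_def using 1 2 by (intro CollectI exI[of _ c']) auto
  qed
  then show ?thesis by (auto simp: DA_mult_def)
qed

section \<open>Kernel distance along two curves ending at one boundary point\<close>

text \<open>Lets the estimates below read off \<open>C \<ge> 0\<close> from a remainder bound at a
  single t.\<close>

lemma norm_le_mult_square_imp_nonneg: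
  fixes t :: real
  assumes "norm z \<le> C * t\<^sup>2" "t > 0"
  shows "C \<ge> 0"
proof -
  have "0 \<le> C * t\<^sup>2" by (rule order_trans[OF norm_ge_zero assms(1)])
  then show ?thesis using assms(2) by (simp add: zero_le_mult_iff)
qed

text \<open>The left side compares the kernel denominators \<open>1 - herm y x\<close> and
  \<open>1 - herm x x\<close>. Split the second argument as p + (x - p): against p the terms of
  order t cancel, because u and u' have the same normal component; against x - p both factors are of
  order t.\<close>

lemma herm_defect_le:
  assumes p: "norm p = 1" and u: "herm u p = 1" and u': "herm u' p = 1"
    and t: "0 < t" "t \<le> 1"
    and x: "norm (x - p + t *\<^sub>R u) \<le> C * t\<^sup>2" and y: "norm (y - p + t *\<^sub>R u') \<le> C * t\<^sup>2"
  shows "cmod (herm (x - y) x) \<le> (2 * C + (C + norm u) * (2 * C + norm u + norm u')) * t\<^sup>2"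
proof -
  define r r' where "r = x - p + t *\<^sub>R u" and "r' = y - p + t *\<^sub>R u'"
  have C: "C \<ge> 0" by (rule norm_le_mult_square_imp_nonneg[OF x t(1)])
  have tt: "t\<^sup>2 \<le> t" using t by (simp add: power2_eq_square mult_left_le)
  have Ct: "C * t\<^sup>2 \<le> C * t" using C tt by (rule mult_left_mono[rotated])
  have xp: "norm (x - p) \<le> (C + norm u) * t"
  proof -
    have "norm (x - p) = norm (r - t *\<^sub>R u)" by (simp add: r_def)
    also have "\<dots> \<le> norm r + t * norm u" using norm_triangle_ineq4[of r "t *\<^sub>R u"] t by simp
    finally show ?thesis using x Ct by (simp add: r_def algebra_simps)
  qed
  have yp: "norm (y - p) \<le> (C + norm u') * t"
  proof -
    have "norm (y - p) = norm (r' - t *\<^sub>R u')" by (simp add: r'_def)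
    also have "\<dots> \<le> norm r' + t * norm u'" using norm_triangle_ineq4[of r' "t *\<^sub>R u'"] t by simp
    finally show ?thesis using y Ct by (simp add: r'_def algebra_simps)
  qed
  have "norm (x - y) \<le> norm (x - p) + norm (y - p)"
    using norm_triangle_ineq4[of "x - p" "y - p"] by simp
  with xp yp have xy: "norm (x - y) \<le> (2 * C + norm u + norm u') * t"
    by (simp add: algebra_simps)
  have "herm (x - y) p = herm (r - r') p"
  proof -
    have "x - y = (r - r') - (t *\<^sub>R u - t *\<^sub>R u')" by (simp add: r_def r'_def)
    then show ?thesis by (simp add: herm_diff_left herm_scaleR_left u u')
  qed
  then have "cmod (herm (x - y) p) \<le> norm (r - r')"
    using norm_herm_le[of "r - r'" p] p by simp
  also have "\<dots> \<le> 2 * C * t\<^sup>2"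
    using norm_triangle_ineq4[of r r'] x y by (simp add: r_def r'_def)
  finally have 1: "cmod (herm (x - y) p) \<le> 2 * C * t\<^sup>2" .
  have "cmod (herm (x - y) (x - p)) \<le> norm (x - y) * norm (x - p)"
    by (rule norm_herm_le)
  also have "\<dots> \<le> ((2 * C + norm u + norm u') * t) * ((C + norm u) * t)"
    using xy xp C t by (intro mult_mono) auto
  finally have 2: "cmod (herm (x - y) (x - p)) \<le> (C + norm u) * (2 * C + norm u + norm u') * t\<^sup>2"
    by (simp add: power2_eq_square mult_ac)
  have "herm (x - y) x = herm (x - y) p + herm (x - y) (x - p)"
    by (simp add: herm_diff_right)
  then have "cmod (herm (x - y) x) \<le> cmod (herm (x - y) p) + cmod (herm (x - y) (x - p))"
    by (metis norm_triangle_ineq)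
  with 1 2 show ?thesis by (simp add: algebra_simps)
qed

text \<open>With remainder r, the point x is p + (r - t u). In the expanded square the term linear
  in t is -2 t because \<open>inner u p = 1\<close>; the others are at most of order t
  squared.\<close>

lemma norm_defect_ge:
  assumes p: "norm p = 1" and u: "herm u p = 1" and t: "0 < t" "t \<le> 1"
    and x: "norm (x - p + t *\<^sub>R u) \<le> C * t\<^sup>2"
  shows "1 - (norm x)\<^sup>2 \<ge> 2 * t - (2 * C + (C + norm u)\<^sup>2) * t\<^sup>2"
proof -
  define r where "r = x - p + t *\<^sub>R u"
  have C: "C \<ge> 0" by (rule norm_le_mult_square_imp_nonneg[OF x t(1)])
  have tt: "t\<^sup>2 \<le> t" using t by (simp add: power2_eq_square mult_left_le)
  have Ct: "C * t\<^sup>2 \<le> C * t" using C tt by (rule mult_left_mono[rotated])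
  have "norm (r - t *\<^sub>R u) \<le> norm r + t * norm u" using norm_triangle_ineq4[of r "t *\<^sub>R u"] t by simp
  also have "\<dots> \<le> (C + norm u) * t" using x Ct by (simp add: r_def algebra_simps)
  finally have 1: "(norm (r - t *\<^sub>R u))\<^sup>2 \<le> (C + norm u)\<^sup>2 * t\<^sup>2"
    by (metis norm_ge_zero power_mono power_mult_distrib)
  have 2: "inner r p \<le> C * t\<^sup>2"
    using norm_cauchy_schwarz[of r p] p x by (simp add: r_def)
  have up: "inner u p = 1" using Re_herm[of u p] u by simp
  have "(norm (p + s))\<^sup>2 = (norm p)\<^sup>2 + 2 * inner s p + (norm s)\<^sup>2" for s
    by (simp add: power2_norm_eq_inner inner_add_left inner_add_right inner_commute[of p s])
  from this[of "r - t *\<^sub>R u"]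
  have "(norm x)\<^sup>2 = (norm p)\<^sup>2 + 2 * inner (r - t *\<^sub>R u) p + (norm (r - t *\<^sub>R u))\<^sup>2"
    by (simp add: r_def)
  also have "\<dots> = 1 + 2 * inner r p - 2 * t + (norm (r - t *\<^sub>R u))\<^sup>2"
    by (simp add: p inner_diff_left up)
  finally show ?thesis using 1 2 by (simp add: algebra_simps)
qed

text \<open>With denominators A, B, D the expression is (1/A - 1/D) + (1/B - 1/D). Each difference
  is a quotient such as (D - A) / (A D), whose numerator is of order t squared while A, B and D are
  at least of order t.\<close>

lemma kernel_diff_bounded:
  fixes x y :: "real \<Rightarrow> complex^'d::finite"
  assumes p: "norm p = 1" and u: "herm u p = 1" and u': "herm u' p = 1"
    and x: "\<forall>\<^sub>F t in at_right 0. norm (x t - p + t *\<^sub>R u) \<le> C * t\<^sup>2"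
    and y: "\<forall>\<^sub>F t in at_right 0. norm (y t - p + t *\<^sub>R u') \<le> C * t\<^sup>2"
  shows "\<exists>K. \<forall>\<^sub>F t in at_right 0. Re (1 / (1 - herm (x t) (x t)) + 1 / (1 - herm (y t) (y t))
              - 2 / (1 - herm (x t) (y t))) \<le> K"
proof -
  \<comment> \<open>\<open>E\<close> dominates the constant of \<open>herm_defect_le\<close> for
    both orders of the two curves, \<open>G\<close> those of \<open>norm_defect_ge\<close>.\<close>
  define E where "E = (2 * C + (C + norm u) * (2 * C + norm u + norm u')) +
     (2 * C + (C + norm u') * (2 * C + norm u' + norm u))"
  define G where "G = \<bar>2 * C + (C + norm u)\<^sup>2\<bar> + \<bar>2 * C + (C + norm u')\<^sup>2\<bar>"
  obtain t0 where "t0 > 0" "norm (x t0 - p + t0 *\<^sub>R u) \<le> C * t0\<^sup>2"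
    using eventually_happens'[OF _ eventually_conj[OF x eventually_at_right_less[of 0]]] by auto
  then have C: "C \<ge> 0" using norm_le_mult_square_imp_nonneg by blast
  have E: "2 * C + (C + norm u) * (2 * C + norm u + norm u') \<le> E"
     "2 * C + (C + norm u') * (2 * C + norm u' + norm u) \<le> E" "E \<ge> 0"
    using C by (auto simp: E_def)
  \<comment> \<open>These thresholds give \<open>G * t \<le> 1\<close> and
    \<open>E * t \<le> 1 / 2\<close>, hence moduli at least t for \<open>A\<close> and
    \<open>B\<close> and at least t / 2 for \<open>D\<close>.\<close>
  have "\<forall>\<^sub>F t in at_right 0. t < min 1 (min (1 / (G + 1)) (1 / (2 * (E + 1))))"
    using E(3) by (intro order_tendstoD(2)[OF tendsto_ident_at]) (auto simp: G_def add_nonneg_pos)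
  then have "\<forall>\<^sub>F t in at_right 0. Re (1 / (1 - herm (x t) (x t)) + 1 / (1 - herm (y t) (y t))
              - 2 / (1 - herm (x t) (y t))) \<le> 4 * E"
    using x y eventually_at_right_less[of "0::real"]
  proof eventually_elim
    case (elim t)
    then have t: "0 < t" "t \<le> 1" by auto
    have Gt: "G * t \<le> 1"
    proof -
      have "(G + 1) * t \<le> (G + 1) * (1 / (G + 1))" using elim by (intro mult_left_mono) (auto simp: G_def)
      also have "\<dots> = 1" by (simp add: G_def)
      finally show ?thesis using t by (simp add: algebra_simps)
    qed
    have Et: "E * t \<le> 1 / 2"
    proof -
      have "(E + 1) * t \<le> (E + 1) * (1 / (2 * (E + 1)))" using elim E by (intro mult_left_mono) auto
      also have "\<dots> = 1/2" using E by simp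
      finally show ?thesis using t by (simp add: algebra_simps)
    qed
    define A B D where "A = 1 - herm (x t) (x t)" and "B = 1 - herm (y t) (y t)"
      and "D = 1 - herm (x t) (y t)"
    have Gtt: "G * t\<^sup>2 \<le> t" "E * t\<^sup>2 \<le> t / 2"
      using mult_right_mono[OF Gt, of t] mult_right_mono[OF Et, of t] t
      by (auto simp: power2_eq_square mult_ac)
    have "(2 * C + (C + norm u)\<^sup>2) * t\<^sup>2 \<le> G * t\<^sup>2" "(2 * C + (C + norm u')\<^sup>2) * t\<^sup>2 \<le> G * t\<^sup>2"
      by (intro mult_right_mono; auto simp: G_def)+
    then have "1 - (norm (x t))\<^sup>2 \<ge> t" "1 - (norm (y t))\<^sup>2 \<ge> t"
      using norm_defect_ge[OF p u t elim(2)] norm_defect_ge[OF p u' t elim(3)] Gtt by linarith+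
    moreover have "A = of_real (1 - (norm (x t))\<^sup>2)" "B = of_real (1 - (norm (y t))\<^sup>2)"
      by (simp_all add: A_def B_def herm_self)
    ultimately have AB: "cmod A \<ge> t" "cmod B \<ge> t"
      using t by (simp_all only: norm_of_real)
    have "D - A = cnj (herm (x t - y t) (x t))"
      by (simp add: D_def A_def herm_diff_left herm_diff_right cnj_herm)
    then have DA: "cmod (D - A) \<le> E * t\<^sup>2"
      using herm_defect_le[OF p u u' t, of "x t" C "y t"] elim E(1)
      by (simp only: complex_mod_cnj) (meson mult_right_mono order_trans zero_le_power2)
    have "D - B = herm (y t - x t) (y t)"
      by (simp add: D_def B_def herm_diff_left)
    then have DB: "cmod (D - B) \<le> E * t\<^sup>2"
      using herm_defect_le[OF p u' u t, of "y t" C "x t"] elim E(2)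
      by (simp only:) (meson mult_right_mono order_trans zero_le_power2)
    have "cmod A \<le> cmod D + cmod (D - A)"
      using norm_triangle_ineq4[of D "D - A"] by simp
    then have D: "cmod D \<ge> t / 2" using AB DA Gtt by linarith
    have *: "Re (1 / Z - 1 / D) \<le> 2 * E" if Z: "cmod Z \<ge> t" "cmod (D - Z) \<le> E * t\<^sup>2" for Z
    proof -
      have nz: "Z \<noteq> 0" "D \<noteq> 0" using Z D t by auto
      have "1 / Z - 1 / D = (D - Z) / (Z * D)" using nz by (simp add: field_simps)
      then have "Re (1 / Z - 1 / D) \<le> cmod ((D - Z) / (Z * D))" by (metis complex_Re_le_cmod)
      also have "\<dots> = cmod (D - Z) / (cmod Z * cmod D)" by (simp add: norm_divide norm_mult)
      also have "\<dots> \<le> (E * t\<^sup>2) / (t * (t / 2))"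
        using Z D t E by (intro frac_le mult_mono) auto
      also have "\<dots> = 2 * E" using t by (simp add: power2_eq_square)
      finally show ?thesis .
    qed
    have "2 / D = 1 / D + 1 / D" by simp
    with *[OF AB(1) DA] *[OF AB(2) DB] have "Re (1 / A + 1 / B - 2 / D) \<le> 4 * E"
      by (simp only: minus_complex.sel plus_complex.sel)
    then show ?case by (simp only: A_def B_def D_def)
  qed
  then show ?thesis by blast
qed

section \<open>Boundary behaviour of embedding maps\<close>

text \<open>By compactness the second derivative is bounded by \<open>L\<close>, so
  \<open>f1\<close> is Lipschitz on the convex disc; the mean value inequality on the segment from x
  to y then gives the quadratic remainder.\<close>

lemma C2_on_closed_disc_Taylor:
  assumes "C2_on_closed_disc f"
  obtains f1 L where
    "\<And>x. x \<in> cball 0 1 \<Longrightarrow> (f has_derivative blinfun_apply (f1 x)) (at x within cball 0 1)"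
    "continuous_on (cball 0 1) f1"
    "\<And>x y. x \<in> cball 0 1 \<Longrightarrow> y \<in> cball 0 1 \<Longrightarrow>
       norm (f y - f x - blinfun_apply (f1 x) (y - x)) \<le> L * (norm (y - x))\<^sup>2"
proof -
  obtain f1 f2 where
    f1: "\<And>x. x \<in> cball 0 1 \<Longrightarrow> (f has_derivative blinfun_apply (f1 x)) (at x within cball 0 1)" and
    f2: "\<And>x. x \<in> cball 0 1 \<Longrightarrow> (f1 has_derivative blinfun_apply (f2 x)) (at x within cball 0 1)" and
    cont: "continuous_on (cball 0 1) f2"
    using assms unfolding C2_on_closed_disc_def by blast
  have "bounded (f2 ` cball 0 1)"
    by (intro compact_imp_bounded compact_continuous_image cont compact_cball)
  then obtain L where L: "\<And>x. x \<in> cball 0 1 \<Longrightarrow> norm (f2 x) \<le> L"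
    unfolding bounded_iff by blast
  have lip: "norm (f1 y - f1 x) \<le> L * norm (y - x)" if "x \<in> cball 0 1" "y \<in> cball 0 1" for x y
    by (rule differentiable_bound[OF convex_cball f2]) (use L that in \<open>auto simp: norm_blinfun.rep_eq\<close>)
  have L0: "L \<ge> 0" by (rule order_trans[OF norm_ge_zero L[of 0]]) simp
  show thesis
  proof (rule that[of f1 L])
    fix x y :: complex assume xy: "x \<in> cball 0 1" "y \<in> cball 0 1"
    then have sub: "closed_segment x y \<subseteq> cball 0 1"
      by (intro closed_segment_subset convex_cball)
    have "norm (f y - f x - blinfun_apply (f1 x) (y - x)) \<le> norm (y - x) * (L * norm (y - x))"
    proof (rule differentiable_bound_linearization[where S = "closed_segment x y" and f' = "\<lambda>z. blinfun_apply (f1 z)"])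
      show "x + t *\<^sub>R (y - x) \<in> closed_segment x y" if "t \<in> {0..1}" for t
        using that by (auto simp: closed_segment_def algebra_simps intro!: exI[of _ t])
      show "(f has_derivative blinfun_apply (f1 z)) (at z within closed_segment x y)"
        if "z \<in> closed_segment x y" for z
        using f1[of z] sub that has_derivative_subset by blast
      show "onorm (blinfun_apply (f1 z) - blinfun_apply (f1 x)) \<le> L * norm (y - x)"
        if z: "z \<in> closed_segment x y" for z
      proof -
        have "onorm (blinfun_apply (f1 z) - blinfun_apply (f1 x)) = norm (f1 z - f1 x)"
          by (simp add: norm_blinfun.rep_eq minus_blinfun.rep_eq fun_diff_def)
        also have "\<dots> \<le> L * norm (z - x)" using lip xy z sub by blast
        also have "\<dots> \<le> L * norm (y - x)"
          using segment_bound1[OF z] L0 by (intro mult_left_mono) (auto simp: norm_minus_commute)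
        finally show ?thesis .
      qed
    qed auto
    then show "norm (f y - f x - blinfun_apply (f1 x) (y - x)) \<le> L * (norm (y - x))\<^sup>2"
      by (simp add: power2_eq_square mult_ac)
  qed (use f1 has_derivative_continuous_on[OF f2] in blast)+
qed

text \<open>A weak Harnack inequality, by applying the Schwarz lemma to the Cayley transform of h.\<close>

lemma Re_pos_norm_ge:
  assumes hol: "h holomorphic_on ball 0 1" and pos: "\<And>z. cmod z < 1 \<Longrightarrow> Re (h z) > 0"
    and z: "cmod z < 1"
  shows "cmod (h z) \<ge> cmod (h 0) * (1 - cmod z) / 2"
proof -
  define q where "q w = (h w - h 0) / (h w + cnj (h 0))" for w
  have nz: "h w + cnj (h 0) \<noteq> 0" if "cmod w < 1" for w
  proof
    assume "h w + cnj (h 0) = 0"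
    then have "Re (h w) + Re (h 0) = 0" by (metis complex_cnj plus_complex.sel(1) zero_complex.sel(1) cnj.sel(1))
    then show False using pos[OF that] pos[of 0] by simp
  qed
  have "q holomorphic_on ball 0 1"
    unfolding q_def[abs_def] by (intro holomorphic_intros hol) (auto simp: nz)
  moreover have q1: "cmod (q w) < 1" if w: "cmod w < 1" for w
  proof -
    \<comment> \<open>This identity shows that the Cayley transform maps the right half-plane into
      the disc.\<close>
    have "(cmod (h w + cnj (h 0)))\<^sup>2 - (cmod (h w - h 0))\<^sup>2 = 4 * Re (h w) * Re (h 0)"
      unfolding cmod_power2 by (simp add: power2_eq_square algebra_simps)
    also have "\<dots> > 0" using pos[OF w] pos[of 0] by simp
    finally have "cmod (h w - h 0) < cmod (h w + cnj (h 0))"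
      by (simp add: power_less_imp_less_base)
    then show ?thesis using nz[OF w] by (simp add: q_def norm_divide)
  qed
  ultimately have qz: "cmod (q z) \<le> cmod z"
    using Schwarz_Lemma(1)[of q z] z by (simp add: q_def)
  \<comment> \<open>The Cayley transform solved for h, so that the Schwarz bound on
    \<open>q z\<close> becomes a lower bound on \<open>h z\<close>.\<close>
  have "(1 - q z) * h z = h 0 + cnj (h 0) * q z"
    using nz[OF z] by (simp add: q_def field_simps)
  then have "cmod (1 - q z) * cmod (h z) = cmod (h 0 + cnj (h 0) * q z)"
    by (metis norm_mult)
  also have "\<dots> \<ge> cmod (h 0) - cmod (h 0) * cmod (q z)"
    using norm_diff_ineq[of "h 0" "cnj (h 0) * q z"] by (simp add: norm_mult)
  finally have "cmod (h 0) - cmod (h 0) * cmod (q z) \<le> cmod (1 - q z) * cmod (h z)" .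
  moreover have "cmod (1 - q z) * cmod (h z) \<le> 2 * cmod (h z)"
    using norm_triangle_ineq4[of 1 "q z"] q1[OF z] by (intro mult_right_mono) auto
  moreover have "cmod (h 0) * cmod (q z) \<le> cmod (h 0) * cmod z"
    using qz by (rule mult_left_mono) simp
  ultimately show ?thesis by (simp add: algebra_simps)
qed

text \<open>\<open>f1 x\<close> is a priori only real-linear. Inside the disc holomorphy makes it
  complex-linear, and continuity of \<open>f1\<close> carries this to the circle.\<close>

lemma derivative_on_cball_complex_linear:
  fixes f :: "complex \<Rightarrow> complex^'d::finite" and f1 :: "complex \<Rightarrow> complex \<Rightarrow>\<^sub>L (complex^'d)"
  assumes hol: "\<And>i. (\<lambda>z. f z $ i) holomorphic_on ball 0 1"
    and f1: "\<And>x. x \<in> cball 0 1 \<Longrightarrow> (f has_derivative blinfun_apply (f1 x)) (at x within cball 0 1)"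
    and cont: "continuous_on (cball 0 1) f1"
    and x: "x \<in> cball 0 1"
  shows "blinfun_apply (f1 x) (\<i> * h) $ i = \<i> * blinfun_apply (f1 x) h $ i"
proof -
  let ?d = "\<lambda>x. blinfun_apply (f1 x) (\<i> * h) $ i - \<i> * blinfun_apply (f1 x) h $ i"
  have zero: "?d z = 0" if z: "z \<in> ball 0 1" for z
  proof -
    have "(f has_derivative blinfun_apply (f1 z)) (at z within ball 0 1)"
      using f1[of z] z by (auto intro: has_derivative_subset)
    then have "(f has_derivative blinfun_apply (f1 z)) (at z)"
      by (simp only: at_within_open[OF z open_ball])
    then have 1: "((\<lambda>w. f w $ i) has_derivative (\<lambda>h. blinfun_apply (f1 z) h $ i)) (at z)"
      by (rule bounded_linear.has_derivative[OF bounded_linear_vec_nth])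
    have "((\<lambda>w. f w $ i) has_field_derivative deriv (\<lambda>w. f w $ i) z) (at z)"
      using holomorphic_derivI[OF hol[of i] open_ball z] .
    then have "((\<lambda>w. f w $ i) has_derivative (*) (deriv (\<lambda>w. f w $ i) z)) (at z)"
      by (simp add: has_field_derivative_def)
    from has_derivative_unique[OF 1 this] show ?thesis
      by (metis (no_types, lifting) mult.left_commute right_minus_eq)
  qed
  have "continuous_on (cball 0 1) (\<lambda>x. blinfun_apply (f1 x) k $ i)" for k
    by (intro bounded_linear.continuous_on[OF bounded_linear_vec_nth]
        blinfun.continuous_on cont continuous_on_const)
  then have "continuous_on (closure (ball 0 1)) ?d"
    by (simp only: closure_ball zero_less_one) (intro continuous_on_diff continuous_on_mult_left)
  moreover have "x \<in> closure (ball 0 1)"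
    using x by (simp only: closure_ball zero_less_one)
  ultimately have "?d x = 0"
    using continuous_constant_on_closure[of "ball 0 1" ?d 0 x] zero by blast
  then show ?thesis by simp
qed

text \<open>Differentiate the constant squared norm of f along the circle through \<xi>, whose
  velocity there is \<open>\<i> * \<xi>\<close>.\<close>

lemma inner_derivative_tangent_eq_0:
  fixes f :: "complex \<Rightarrow> 'a::real_inner"
  assumes f': "(f has_derivative f') (at \<xi> within cball 0 1)"
    and sphere: "\<And>x. cmod x = 1 \<Longrightarrow> norm (f x) = 1" and \<xi>: "cmod \<xi> = 1"
  shows "inner (f \<xi>) (f' (\<i> * \<xi>)) = 0"
proof -
  define c where "c \<theta> = cis \<theta> * \<xi>" for \<theta>
  have c: "(c has_derivative (\<lambda>h. (h *\<^sub>R (\<i> * cis 0)) * \<xi>)) (at 0)"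
    unfolding c_def by (auto intro!: derivative_eq_intros)
  have c1: "cmod (c \<theta>) = 1" for \<theta> by (simp add: c_def norm_mult \<xi>)
  have c0: "c 0 = \<xi>" by (simp add: c_def)
  have "(f has_derivative f') (at (c 0) within range c)"
    unfolding c0 using f' by (rule has_derivative_subset) (auto simp: c1)
  from diff_chain_within[OF c this]
  have F: "((f \<circ> c) has_derivative (\<lambda>h. f' ((h *\<^sub>R (\<i> * cis 0)) * \<xi>))) (at 0)"
    by (simp add: o_def)
  have "((\<lambda>\<theta>. inner ((f \<circ> c) \<theta>) ((f \<circ> c) \<theta>)) has_derivative
     (\<lambda>h. inner ((f \<circ> c) 0) (f' ((h *\<^sub>R (\<i> * cis 0)) * \<xi>)) + inner (f' ((h *\<^sub>R (\<i> * cis 0)) * \<xi>)) ((f \<circ> c) 0))) (at 0)"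
    by (rule has_derivative_inner[OF F F])
  moreover have "(\<lambda>\<theta>. inner ((f \<circ> c) \<theta>) ((f \<circ> c) \<theta>)) = (\<lambda>_. 1)"
    using sphere[OF c1] by (auto simp: norm_eq_1)
  ultimately have "((\<lambda>_. 1) has_derivative
     (\<lambda>h. inner (f \<xi>) (f' ((h *\<^sub>R (\<i> * cis 0)) * \<xi>)) + inner (f' ((h *\<^sub>R (\<i> * cis 0)) * \<xi>)) (f \<xi>))) (at (0::real))"
    by (simp only: c0 o_def)
  from has_derivative_unique[OF this has_derivative_const[of 1 "at 0"]]
  have "inner (f \<xi>) (f' ((1 *\<^sub>R (\<i> * cis 0)) * \<xi>)) + inner (f' ((1 *\<^sub>R (\<i> * cis 0)) * \<xi>)) (f \<xi>) = 0"
    by (rule fun_cong)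
  then show ?thesis by (simp add: inner_commute)
qed

text \<open>The approach is radial, with u the radial derivative v divided by its normal component
  \<open>a\<close>. Tangency to the sphere makes \<open>a\<close> real, and Hopf's argument makes it
  positive.\<close>

lemma embedding_map_boundary_approach:
  assumes f: "embedding_map f V" and \<xi>: "cmod \<xi> = 1"
  obtains X u C where "(X \<longlongrightarrow> \<xi>) (at_right (0::real))"
    "\<forall>\<^sub>F t in at_right 0. cmod (X t) < 1"
    "\<forall>\<^sub>F t in at_right 0. norm (f (X t) - f \<xi> + t *\<^sub>R u) \<le> C * t\<^sup>2"
    "herm u (f \<xi>) = 1"
proof -
  define p where "p = f \<xi>"
  have hol: "\<And>i. (\<lambda>z. f z $ i) holomorphic_on ball 0 1"
    and C2: "C2_on_closed_disc f"
    and bd: "\<And>x. x \<in> cball 0 1 \<Longrightarrow> norm (f x) = 1 \<longleftrightarrow> cmod x = 1"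
    and ball: "f ` ball 0 1 \<subseteq> ball 0 1"
    using f unfolding embedding_map_def by blast+
  obtain f1 L where
    f1: "\<And>x. x \<in> cball 0 1 \<Longrightarrow> (f has_derivative blinfun_apply (f1 x)) (at x within cball 0 1)" and
    cont: "continuous_on (cball 0 1) f1" and
    tay: "\<And>x y. x \<in> cball 0 1 \<Longrightarrow> y \<in> cball 0 1 \<Longrightarrow>
       norm (f y - f x - blinfun_apply (f1 x) (y - x)) \<le> L * (norm (y - x))\<^sup>2"
    using C2_on_closed_disc_Taylor[OF C2] by blast
  have \<xi>c: "\<xi> \<in> cball 0 1" using \<xi> by simp
  have p1: "norm p = 1" unfolding p_def using bd[OF \<xi>c] \<xi> by simp
  define v where "v = blinfun_apply (f1 \<xi>) \<xi>"
  define a where "a = herm v p"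
  have lin: "blinfun_apply (f1 \<xi>) (\<i> * \<xi>) $ i = \<i> * v $ i" for i
    unfolding v_def by (rule derivative_on_cball_complex_linear[OF hol f1 cont \<xi>c])
  \<comment> \<open>Complex linearity makes the tangential derivative \<i> times the radial one, so
    orthogonality to p reads \<open>Im a = 0\<close>.\<close>
  have "herm (blinfun_apply (f1 \<xi>) (\<i> * \<xi>)) p = \<i> * a"
    by (simp add: herm_def a_def lin sum_distrib_left mult_ac)
  then have "inner (blinfun_apply (f1 \<xi>) (\<i> * \<xi>)) p = - Im a"
    using Re_herm[of "blinfun_apply (f1 \<xi>) (\<i> * \<xi>)" p] by simp
  moreover have "inner (f \<xi>) (blinfun_apply (f1 \<xi>) (\<i> * \<xi>)) = 0"
    by (rule inner_derivative_tangent_eq_0[OF f1[OF \<xi>c] _ \<xi>]) (use bd in auto)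
  ultimately have Im: "Im a = 0" by (simp add: p_def inner_commute)
  have ms: "cmod ((1 - of_real s) * \<xi>) = 1 - s" if "0 < s" "s \<le> 1" for s
  proof -
    have "(1 - of_real s) * \<xi> = of_real (1 - s) * \<xi>" by simp
    then show ?thesis using that \<xi> by (simp only: norm_mult norm_of_real) simp
  qed
  have exp: "norm (f ((1 - of_real s) * \<xi>) - p + s *\<^sub>R v) \<le> L * s\<^sup>2" if s: "0 < s" "s \<le> 1" for s
  proof -
    have "(1 - of_real s) * \<xi> \<in> cball 0 1"
      using ms[OF s] s by simp
    from tay[OF \<xi>c this] 
    have "norm (f ((1 - of_real s) * \<xi>) - p - blinfun_apply (f1 \<xi>) (- s *\<^sub>R \<xi>)) \<le> L * s\<^sup>2"
      using \<xi> by (simp add: p_def algebra_simps norm_mult scaleR_conv_of_real)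
    then show ?thesis by (simp add: blinfun.scaleR_right blinfun.minus_right v_def)
  qed
  \<comment> \<open>\<open>h\<close> has positive real part in the disc, vanishes at \<xi>, and has
    first-order term \<open>s * a\<close> at distance s along the radius. This is the function for
    Hopf's argument.\<close>
  define h where "h z = 1 - herm (f z) p" for z
  have hpos: "Re (h z) > 0" if "cmod z < 1" for z
  proof -
    have "norm (f z) < 1" using ball that by (auto simp: image_subset_iff)
    then show ?thesis
      using complex_Re_le_cmod[of "herm (f z) p"] norm_herm_le[of "f z" p] by (simp add: h_def p1)
  qed
  have hhol: "h holomorphic_on ball 0 1"
    unfolding h_def[abs_def] herm_def by (intro holomorphic_intros hol)
  have hs: "cmod (h ((1 - of_real s) * \<xi>) - of_real s * a) \<le> L * s\<^sup>2" if s: "0 < s" "s \<le> 1" for s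
  proof -
    have "herm (f ((1 - of_real s) * \<xi>) - p + s *\<^sub>R v) p = - (h ((1 - of_real s) * \<xi>) - of_real s * a)"
    proof -
      have "f ((1 - of_real s) * \<xi>) - p + s *\<^sub>R v = f ((1 - of_real s) * \<xi>) - (p - s *\<^sub>R v)" by simp
      then show ?thesis
        by (simp only: herm_diff_left herm_scaleR_left) (simp add: h_def a_def herm_self p1)
    qed
    then have "cmod (h ((1 - of_real s) * \<xi>) - of_real s * a) \<le> norm (f ((1 - of_real s) * \<xi>) - p + s *\<^sub>R v) * norm p"
      by (metis norm_herm_le norm_minus_cancel)
    then show ?thesis using exp[OF s] p1 by simp
  qed
  \<comment> \<open>The expansion \<open>hs\<close> is compared with \<open>Re H > 0\<close> and
    with the lower bound of \<open>Re_pos_norm_ge\<close>, where \<open>1 - cmod z\<close> equals s;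
    both are divided by s.\<close>
  have lo: "- (L * s) \<le> Re a" "cmod (h 0) / 2 \<le> cmod a + L * s" if s: "0 < s" "s \<le> 1" for s
  proof -
    define H where "H = h ((1 - of_real s) * \<xi>)"
    have H: "Re H > 0" "cmod (h 0) * (1 - (1 - s)) / 2 \<le> cmod H"
      using hpos[of "(1 - of_real s) * \<xi>"] Re_pos_norm_ge[OF hhol hpos, of "(1 - of_real s) * \<xi>"] ms[OF s] s
      by (simp_all add: H_def)
    have "Re H - s * Re a \<le> L * s\<^sup>2"
      using hs[OF s] complex_Re_le_cmod[of "H - of_real s * a"] by (simp add: H_def)
    then have "0 \<le> s * (Re a + L * s)" using H(1) by (simp add: power2_eq_square algebra_simps)
    then show "- (L * s) \<le> Re a" using s by (simp add: zero_le_mult_iff)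
    have "cmod H \<le> cmod (of_real s * a) + cmod (H - of_real s * a)"
      using norm_triangle_ineq[of "of_real s * a" "H - of_real s * a"] by simp
    then have "cmod H \<le> s * cmod a + L * s\<^sup>2"
      using hs[OF s] s by (simp add: H_def norm_mult)
    with H(2) have "s * (cmod (h 0) / 2) \<le> s * (cmod a + L * s)"
      by (simp add: power2_eq_square algebra_simps)
    then show "cmod (h 0) / 2 \<le> cmod a + L * s" using s by simp
  qed
  have ev: "\<forall>\<^sub>F s in at_right 0. 0 < s \<and> s \<le> (1::real)"
    by (auto simp: eventually_at_right_field intro!: exI[of _ 1])
  have lim: "((\<lambda>s. L * s) \<longlongrightarrow> L * 0) (at_right 0)"
    by (intro tendsto_intros)
  have "Re a \<ge> 0"
  proof -
    have "\<forall>\<^sub>F s in at_right 0. - (L * s) \<le> Re a"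
      using ev lo(1) by (auto elim: eventually_mono)
    from tendsto_upperbound[OF tendsto_minus[OF lim] this] show ?thesis by simp
  qed
  moreover have "cmod (h 0) / 2 \<le> cmod a"
  proof -
    have "\<forall>\<^sub>F s in at_right 0. cmod (h 0) / 2 \<le> cmod a + L * s"
      using ev lo(2) by (auto elim: eventually_mono)
    from tendsto_lowerbound[OF tendsto_add[OF tendsto_const lim] this] show ?thesis by simp
  qed
  moreover have "h 0 \<noteq> 0" using hpos[of 0] by auto
  ultimately have "Re a \<noteq> 0" using Im complex_eqI[of a 0] by fastforce
  with \<open>Re a \<ge> 0\<close> have a: "Re a > 0" by simp
  have a_eq: "a = of_real (Re a)" using Im by (simp add: complex_eq_iff)
  \<comment> \<open>The parameter s = t / Re a normalises the normal speed to 1 and turns the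
    remainder constant \<open>L\<close> into \<open>L / (Re a)\<^sup>2\<close>.\<close>
  define X where "X t = (1 - of_real (t / Re a)) * \<xi>" for t :: real
  have lim0: "((\<lambda>t. t / Re a) \<longlongrightarrow> 0 / Re a) (at_right 0)"
    using a by (intro tendsto_intros) auto
  have ev': "\<forall>\<^sub>F t in at_right 0. 0 < t / Re a \<and> t / Re a \<le> 1"
  proof -
    have "\<forall>\<^sub>F t in at_right 0. t / Re a < 1" using lim0 by (intro order_tendstoD(2)) auto
    with eventually_at_right_less[of 0] show ?thesis
      by eventually_elim (use a in auto)
  qed
  show thesis
  proof (rule that[of X "(1 / Re a) *\<^sub>R v" "L / (Re a)\<^sup>2"])
    have "(X \<longlongrightarrow> (1 - of_real (0 / Re a)) * \<xi>) (at_right 0)"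
      unfolding X_def by (intro tendsto_intros lim0)
    then show "(X \<longlongrightarrow> \<xi>) (at_right 0)" by simp
    show "\<forall>\<^sub>F t in at_right 0. cmod (X t) < 1"
      using ev' by eventually_elim (simp add: X_def ms del: of_real_divide)
    show "\<forall>\<^sub>F t in at_right 0. norm (f (X t) - f \<xi> + t *\<^sub>R (1 / Re a) *\<^sub>R v) \<le> L / (Re a)\<^sup>2 * t\<^sup>2"
      using ev'
    proof eventually_elim
      case (elim t)
      then show ?case using exp[of "t / Re a"]
        by (simp add: X_def p_def power_divide)
    qed
    show "herm ((1 / Re a) *\<^sub>R v) (f \<xi>) = 1"
    proof -
      have "herm ((1 / Re a) *\<^sub>R v) (f \<xi>) = of_real (1 / Re a) * of_real (Re a)"
        using a_eq by (simp only: herm_scaleR_left a_def p_def)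
      then show ?thesis using a by simp
    qed
  qed
qed

section \<open>Transfer of self-crossings\<close>

text \<open>The inclusion carries crossings of f to g; equality of the algebras permits the same
  with f and g exchanged.\<close>

lemma boundary_crossing_transfer:
  fixes f g :: "complex \<Rightarrow> complex^'d::finite"
  assumes f: "embedding_map f V" and g: "embedding_map g W" and sub: "mult_f g \<subseteq> mult_f f"
    and \<xi>: "cmod \<xi> = 1" and \<zeta>: "cmod \<zeta> = 1" and eq: "f \<xi> = f \<zeta>"
  shows "g \<xi> = g \<zeta>"
proof -
  define p where "p = f \<xi>"
  obtain X u C where X: "(X \<longlongrightarrow> \<xi>) (at_right (0::real))"
    "\<forall>\<^sub>F t in at_right 0. cmod (X t) < 1"
    "\<forall>\<^sub>F t in at_right 0. norm (f (X t) - f \<xi> + t *\<^sub>R u) \<le> C * t\<^sup>2"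
    "herm u (f \<xi>) = 1"
    using embedding_map_boundary_approach[OF f \<xi>] by blast
  obtain Y u' C' where Y: "(Y \<longlongrightarrow> \<zeta>) (at_right (0::real))"
    "\<forall>\<^sub>F t in at_right 0. cmod (Y t) < 1"
    "\<forall>\<^sub>F t in at_right 0. norm (f (Y t) - f \<zeta> + t *\<^sub>R u') \<le> C' * t\<^sup>2"
    "herm u' (f \<zeta>) = 1"
    using embedding_map_boundary_approach[OF f \<zeta>] by blast
  have cont: "continuous_on (cball 0 1) F" if "embedding_map F U" for F :: "complex \<Rightarrow> complex^'d" and U
    using that by (auto simp: embedding_map_def C2_on_closed_disc_def intro: has_derivative_continuous_on)
  have lim: "((\<lambda>t. F (Z t)) \<longlongrightarrow> F \<eta>) (at_right (0::real))"
    if "embedding_map F U" "(Z \<longlongrightarrow> \<eta>) (at_right 0)" "cmod \<eta> = 1" "\<forall>\<^sub>F t in at_right 0. cmod (Z t) < 1"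
    for F :: "complex \<Rightarrow> complex^'d" and U Z \<eta>
    by (rule continuous_on_tendsto_compose[OF cont[OF that(1)] that(2)])
      (use that(3,4) in \<open>auto elim: eventually_mono\<close>)
  have p1: "norm p = 1"
    using f \<xi> by (auto simp: embedding_map_def p_def)
  have "\<forall>\<^sub>F t in at_right 0. norm (f (X t) - p + t *\<^sub>R u) \<le> max C C' * t\<^sup>2"
    using X(3) by eventually_elim (auto simp: p_def intro!: mult_right_mono elim!: order_trans)
  moreover have "\<forall>\<^sub>F t in at_right 0. norm (f (Y t) - p + t *\<^sub>R u') \<le> max C C' * t\<^sup>2"
    using Y(3) by eventually_elim (auto simp: p_def eq intro!: mult_right_mono elim!: order_trans)
  ultimately obtain K where K: "\<forall>\<^sub>F t in at_right 0.
      Re (1 / (1 - herm (f (X t)) (f (X t))) + 1 / (1 - herm (f (Y t)) (f (Y t)))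
        - 2 / (1 - herm (f (X t)) (f (Y t)))) \<le> K"
    using kernel_diff_bounded[OF p1, of u u' "\<lambda>t. f (X t)" "max C C'" "\<lambda>t. f (Y t)"] X(4) Y(4) eq
    by (auto simp: p_def)
  have ball: "norm (f z) < 1" if "cmod z < 1" for z
    using f that by (auto simp: embedding_map_def image_subset_iff)
  have "g \<xi> $ i = g \<zeta> $ i" for i
  proof -
    have "restrict ((\<lambda>z. z $ i) \<circ> g) (ball 0 1) \<in> mult_f g"
      using coord_in_DA_mult[of i] by (auto simp: mult_f_def)
    \<comment> \<open>The inclusion writes the coordinate of g as a multiplier composed with f on
      the open disc; boundary values are recovered below as limits along X and Y.\<close>
    then obtain \<phi> :: "complex^'d \<Rightarrow> complex" where \<phi>: "\<phi> \<in> DA_mult"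
      and r: "restrict ((\<lambda>z. z $ i) \<circ> g) (ball 0 1) = restrict (\<phi> \<circ> f) (ball 0 1)"
      using sub by (auto simp: mult_f_def)
    have \<phi>g: "\<phi> (f z) = g z $ i" if "cmod z < 1" for z
      using fun_cong[OF r, of z] that by simp
    have "\<phi> \<in> DA_space"
      using \<phi> one_in_DA_space by (fastforce simp: DA_mult_def)
    then have "((\<lambda>t. \<phi> (f (X t)) - \<phi> (f (Y t))) \<longlongrightarrow> 0) (at_right 0)"
    proof (rule DA_space_diff_tendsto_0[OF _ _ _ _ K])
      show "((\<lambda>t. f (X t)) \<longlongrightarrow> p) (at_right 0)" "((\<lambda>t. f (Y t)) \<longlongrightarrow> p) (at_right 0)"
        using lim[OF f X(1) \<xi> X(2)] lim[OF f Y(1) \<zeta> Y(2)] by (simp_all add: p_def eq)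
      show "\<forall>\<^sub>F t in at_right 0. norm (f (X t)) < 1 \<and> norm (f (Y t)) < 1"
        using X(2) Y(2) by eventually_elim (auto intro: ball)
    qed
    moreover have "\<forall>\<^sub>F t in at_right 0. \<phi> (f (X t)) - \<phi> (f (Y t)) = g (X t) $ i - g (Y t) $ i"
      using X(2) Y(2) by eventually_elim (simp add: \<phi>g)
    ultimately have "((\<lambda>t. g (X t) $ i - g (Y t) $ i) \<longlongrightarrow> 0) (at_right 0)"
      by (simp add: tendsto_cong)
    moreover have "((\<lambda>t. g (X t) $ i - g (Y t) $ i) \<longlongrightarrow> g \<xi> $ i - g \<zeta> $ i) (at_right 0)"
      by (intro tendsto_intros lim[OF g X(1) \<xi> X(2)] lim[OF g Y(1) \<zeta> Y(2)])
    ultimately show ?thesis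
      using tendsto_unique[OF trivial_limit_at_right_real] by fastforce
  qed
  then show ?thesis by (simp add: vec_eq_iff)
qed

theorem theorem1p1:
  fixes f g :: "complex \<Rightarrow> complex^'d::finite"
    and V W :: "(complex^'d) set"
  assumes "embedding_map f V"
    and "embedding_map g W"
    and "mult_f f = mult_f g"
  shows "\<forall>\<xi> \<zeta>. cmod \<xi> = 1 \<longrightarrow> cmod \<zeta> = 1 \<longrightarrow> (f \<xi> = f \<zeta> \<longleftrightarrow> g \<xi> = g \<zeta>)"
  using boundary_crossing_transfer[OF assms(1,2)] boundary_crossing_transfer[OF assms(2,1)] assms(3)
  by blast

end
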